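(* Given commodities $\{(s_k,t_k,d_k) : k\in\mathcal{K}\}$ and edge capacities $\{u_{ij} : (i,j)\in E\}$ on a directed graph $G(V,E)$, the feasible region of the multicommodity flow constraints (MCF) is empty if and only if there exists a nonzero-stable pseudo-flow.
   Context: Setting. $G(V,E)$ is a finite directed graph; $\delta^+(i)=\{j : (i,j)\in E\}$, $\delta^-(i)=\{j : (j,i)\in E\}$, and $\delta_i=|\delta^+(i)|+|\delta^-(i)|$ is the degree of vertex $i$, with $\delta_i\ge 1$ for every $i\in V$. Each edge has a capacity $u_{ij}\in\mathbb{Q}$, $u_{ij}>0$. There is a finite set of commodities $\mathcal{K}=\{1,\dots,K\}$; commodity $k$ has an origin $s_k\in V$, a destination $t_k\in V$ with $s_k\ne t_k$, and a demand $d_k$ (a real number). The multicommodity flow constraints (MCF) on real variables $f_{ij,k}$, $(i,j)\in E$, $k\in\mathcal{K}$, are: $\sum_{k\in\mathcal{K}} f_{ij,k}\le u_{ij}$ for all $(i,j)\in E$; $f_{ij,k}\ge 0$ for all $k\in\mathcal{K}$, $(i,j)\in E$; and, for all $k\in\mathcal{K}$, $i\in V$, $\sum_{j\in\delta^+(i)} f_{ij,k}-\sum_{j\in\delta^-(i)} f_{ji,k}$ equals $d_k$ if $i=s_k$, equals $-d_k$ if $i=t_k$, and equals $0$ otherwise. A pseudo-flow is any family $\boldsymbol{f}=(f_{ij,k})_{(i,j)\in E,\,k\in\mathcal{K}}$ of nonnegative real numbers (capacity and conservation constraints are not required). For a pseudo-flow put $f_{ij}=\sum_{k\in\mathcal{K}}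 f_{ij,k}$ and $$\Delta_{ik}=\sum_{j\in\delta^-(i)} f_{ji,k}-\sum_{j\in\delta^+(i)} f_{ij,k}+\hat\Delta_{ik},$$ where $\hat\Delta_{ik}=d_k$ if $i=s_k$, $\hat\Delta_{ik}=-d_k$ if $i=t_k$, and $\hat\Delta_{ik}=0$ otherwise. The height is $h_{ik}=\Delta_{ik}/\delta_i$. The congestion is $\psi_{ij}=0$ if $f_{ij}\le u_{ij}$ and $\psi_{ij}=f_{ij}-u_{ij}$ if $f_{ij}>u_{ij}$. The potential difference is $\phi_{ij,k}=h_{ik}-h_{jk}-\psi_{ij}$. A pseudo-flow is stable if for all $(i,j)\in E$, $k\in\mathcal{K}$: (i) if $f_{ij,k}>0$ then $\phi_{ij,k}=0$; (ii) if $f_{ij,k}=0$ then $\phi_{ij,k}\le 0$. A stable pseudo-flow is zero-stable if $\psi_{ij}=0$ for all $(i,j)\in E$ and $h_{ik}=0$ for all $i\in V$, $k\in\mathcal{K}$; otherwise it is nonzero-stable. *)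

theory Defs
  imports "HOL-Analysis.Analysis" "Graph_Theory.Pair_Digraph"
begin

text \<open>
  Arcs are pairs of vertices, so there are no parallel arcs; loops are permitted. The commodities
  are \<open>{1..K}\<close>. A family indexed by arcs and commodities is represented by a total function
  \<open>f\<close>, with \<open>f (i, j) k\<close> standing for $f_{ij,k}$; its values outside
  \<open>parcs G\<close> and \<open>{1..K}\<close> are never inspected.
\<close>

type_synonym 'v flow = "'v \<times> 'v \<Rightarrow> nat \<Rightarrow> real"

definition out_nbrs :: "'v pair_pre_digraph \<Rightarrow> 'v \<Rightarrow> 'v set" where
  "out_nbrs G i = {j. (i, j) \<in> parcs G}"

definition in_nbrs :: "'v pair_pre_digraph \<Rightarrow> 'v \<Rightarrow> 'v set" where
  "in_nbrs G i = {j. (j, i) \<in> parcs G}"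

definition vdegree :: "'v pair_pre_digraph \<Rightarrow> 'v \<Rightarrow> nat" where
  "vdegree G i = card (out_nbrs G i) + card (in_nbrs G i)"

text \<open>
  The net supply is both the right-hand side of flow conservation and the term
  $\hat\Delta_{ik}$ in the excess of a pseudo-flow.
\<close>

definition net_supply ::
  "(nat \<Rightarrow> 'v) \<Rightarrow> (nat \<Rightarrow> 'v) \<Rightarrow> (nat \<Rightarrow> real) \<Rightarrow> 'v \<Rightarrow> nat \<Rightarrow> real" where
  "net_supply s t d i k = (if i = s k then d k else if i = t k then - d k else 0)"

definition total_flow :: "nat \<Rightarrow> 'v flow \<Rightarrow> 'v \<times> 'v \<Rightarrow> real" where
  "total_flow K f e = (\<Sum>k\<in>{1..K}. f e k)"

definition mcf_feasible_region ::
  "'v pair_pre_digraph \<Rightarrow> nat \<Rightarrow> ('v \<times> 'v \<Rightarrow> real) \<Rightarrow> (nat \<Rightarrow> 'v) \<Rightarrow> (nat \<Rightarrow> 'v) \<Rightarrow> (nat \<Rightarrow> real)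
    \<Rightarrow> 'v flow set" where
  "mcf_feasible_region G K u s t d =
    {f. (\<forall>e\<in>parcs G. total_flow K f e \<le> u e) \<and>
        (\<forall>k\<in>{1..K}. \<forall>e\<in>parcs G. 0 \<le> f e k) \<and>
        (\<forall>k\<in>{1..K}. \<forall>i\<in>pverts G.
          (\<Sum>j\<in>out_nbrs G i. f (i, j) k) - (\<Sum>j\<in>in_nbrs G i. f (j, i) k) = net_supply s t d i k)}"

definition pseudo_flow :: "'v pair_pre_digraph \<Rightarrow> nat \<Rightarrow> 'v flow \<Rightarrow> bool" where
  "pseudo_flow G K f \<longleftrightarrow> (\<forall>e\<in>parcs G. \<forall>k\<in>{1..K}. 0 \<le> f e k)"

definition excess ::
  "'v pair_pre_digraph \<Rightarrow> (nat \<Rightarrow> 'v) \<Rightarrow> (nat \<Rightarrow> 'v) \<Rightarrow> (nat \<Rightarrow> real) \<Rightarrow> 'v flow \<Rightarrow> 'v \<Rightarrow> nat \<Rightarrow> real" where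
  "excess G s t d f i k =
    (\<Sum>j\<in>in_nbrs G i. f (j, i) k) - (\<Sum>j\<in>out_nbrs G i. f (i, j) k) + net_supply s t d i k"

definition height ::
  "'v pair_pre_digraph \<Rightarrow> (nat \<Rightarrow> 'v) \<Rightarrow> (nat \<Rightarrow> 'v) \<Rightarrow> (nat \<Rightarrow> real) \<Rightarrow> 'v flow \<Rightarrow> 'v \<Rightarrow> nat \<Rightarrow> real" where
  "height G s t d f i k = excess G s t d f i k / real (vdegree G i)"

definition congestion :: "nat \<Rightarrow> ('v \<times> 'v \<Rightarrow> real) \<Rightarrow> 'v flow \<Rightarrow> 'v \<times> 'v \<Rightarrow> real" where
  "congestion K u f e = (if total_flow K f e \<le> u e then 0 else total_flow K f e - u e)"

definition potential_diff ::
  "'v pair_pre_digraph \<Rightarrow> nat \<Rightarrow> ('v \<times> 'v \<Rightarrow> real) \<Rightarrow> (nat \<Rightarrow> 'v) \<Rightarrow> (nat \<Rightarrow> 'v) \<Rightarrow> (nat \<Rightarrow> real)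
    \<Rightarrow> 'v flow \<Rightarrow> 'v \<times> 'v \<Rightarrow> nat \<Rightarrow> real" where
  "potential_diff G K u s t d f e k =
    height G s t d f (fst e) k - height G s t d f (snd e) k - congestion K u f e"

definition stable ::
  "'v pair_pre_digraph \<Rightarrow> nat \<Rightarrow> ('v \<times> 'v \<Rightarrow> real) \<Rightarrow> (nat \<Rightarrow> 'v) \<Rightarrow> (nat \<Rightarrow> 'v) \<Rightarrow> (nat \<Rightarrow> real)
    \<Rightarrow> 'v flow \<Rightarrow> bool" where
  "stable G K u s t d f \<longleftrightarrow> pseudo_flow G K f \<and>
    (\<forall>e\<in>parcs G. \<forall>k\<in>{1..K}.
      (f e k > 0 \<longrightarrow> potential_diff G K u s t d f e k = 0) \<and>
      (f e k = 0 \<longrightarrow> potential_diff G K u s t d f e k \<le> 0))"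

definition zero_stable ::
  "'v pair_pre_digraph \<Rightarrow> nat \<Rightarrow> ('v \<times> 'v \<Rightarrow> real) \<Rightarrow> (nat \<Rightarrow> 'v) \<Rightarrow> (nat \<Rightarrow> 'v) \<Rightarrow> (nat \<Rightarrow> real)
    \<Rightarrow> 'v flow \<Rightarrow> bool" where
  "zero_stable G K u s t d f \<longleftrightarrow> stable G K u s t d f \<and>
    (\<forall>e\<in>parcs G. congestion K u f e = 0) \<and>
    (\<forall>i\<in>pverts G. \<forall>k\<in>{1..K}. height G s t d f i k = 0)"

definition nonzero_stable ::
  "'v pair_pre_digraph \<Rightarrow> nat \<Rightarrow> ('v \<times> 'v \<Rightarrow> real) \<Rightarrow> (nat \<Rightarrow> 'v) \<Rightarrow> (nat \<Rightarrow> 'v) \<Rightarrow> (nat \<Rightarrow> real)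
    \<Rightarrow> 'v flow \<Rightarrow> bool" where
  "nonzero_stable G K u s t d f \<longleftrightarrow> stable G K u s t d f \<and> \<not> zero_stable G K u s t d f"

end

theory Submission
  imports Defs
begin

text \<open>
  Stability is the first-order optimality condition of a convex program. Assign to a pseudo-flow
  the energy $P(f) = \sum_{i,k} \delta_i h_{ik}^2 + \sum_e \psi_e^2$. Its partial derivative with
  respect to $f_{e,k}$ is $-2\phi_{e,k}$, so the two clauses of stability are precisely the
  Karush-Kuhn-Tucker conditions for minimising $P$ over the nonnegative orthant. The zeros of
  $P$ among the pseudo-flows are precisely the feasible flows (\<open>feasible_iff_energy_zero\<close>), and
  the zero-stable pseudo-flows are precisely the stable ones of energy zero.

  Since $P$ is convex, it lies above its tangent planes (\<open>energy_ge_tangent\<close>). Hence a stable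
  pseudo-flow has minimal energy, and its energy is zero as soon as a feasible flow exists
  (\<open>stable_energy_minimal\<close>). So a nonzero-stable pseudo-flow rules out feasibility.

  Conversely, a stable pseudo-flow always exists (\<open>stable_exists\<close>), and when nothing is feasible
  it cannot be zero-stable. It is found as a minimiser of $P$. The conservation terms alone do not
  bound a pseudo-flow, since they ignore circulations, but a large value of $f_{e,k}$ congests
  $e$. So the energy exceeds $P(0)$ on the upper faces of a large enough box, and the
  minimiser over that compact box touches none of these faces. There it may be perturbed in one
  coordinate, upwards always and downwards if that coordinate is positive. A quadratic upper bound
  on the effect of the perturbation (\<open>energy_le_quadratic\<close>) yields the stability conditions.
\<close>

section \<open>Summation by parts on a digraph\<close>

definition net_inflow :: "'v pair_pre_digraph \<Rightarrow> ('v \<times> 'v \<Rightarrow> real) \<Rightarrow> 'v \<Rightarrow> real" where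
  "net_inflow G x i = (\<Sum>j\<in>in_nbrs G i. x (j, i)) - (\<Sum>j\<in>out_nbrs G i. x (i, j))"

lemma net_inflow_add: "net_inflow G (\<lambda>e. x e + y e) i = net_inflow G x i + net_inflow G y i"
  by (simp add: net_inflow_def sum.distrib)

lemma net_inflow_scale: "net_inflow G (\<lambda>e. c * x e) i = c * net_inflow G x i"
  by (simp add: net_inflow_def sum_distrib_left right_diff_distrib)

lemma excess_eq_net_inflow:
  "excess G s t d f i k = net_inflow G (\<lambda>e. f e k) i + net_supply s t d i k"
  by (simp add: excess_def net_inflow_def)

lemma (in pair_fin_digraph) sum_out_nbrs:
  "(\<Sum>i\<in>pverts G. \<Sum>j\<in>out_nbrs G i. y (i, j)) = (\<Sum>e\<in>parcs G. y e :: real)"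
proof -
  have fin: "finite (out_nbrs G i)" for i
  proof (rule finite_subset)
    show "out_nbrs G i \<subseteq> snd ` parcs G"
      by (force simp: out_nbrs_def)
  qed simp
  have "parcs G = Sigma (pverts G) (out_nbrs G)"
    by (auto simp: out_nbrs_def dest: arc_fst_in_verts)
  then show ?thesis
    by (simp add: sum.Sigma fin)
qed

lemma (in pair_fin_digraph) sum_in_nbrs:
  "(\<Sum>i\<in>pverts G. \<Sum>j\<in>in_nbrs G i. y (j, i)) = (\<Sum>e\<in>parcs G. y e :: real)"
proof -
  have fin: "finite (in_nbrs G i)" for i
  proof (rule finite_subset)
    show "in_nbrs G i \<subseteq> fst ` parcs G"
      by (force simp: in_nbrs_def)
  qed simp
  have "j \<in> pverts G" if "(i, j) \<in> parcs G" for i j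
    using arc_snd_in_verts[OF that] by simp
  then have "parcs G = prod.swap ` Sigma (pverts G) (in_nbrs G)"
    by (auto simp: in_nbrs_def image_iff)
  then have "(\<Sum>e\<in>parcs G. y e) = (\<Sum>(i, j)\<in>Sigma (pverts G) (in_nbrs G). y (j, i))"
    by (simp only: sum.reindex[OF inj_swap] o_def case_prod_unfold prod.swap_def)
  then show ?thesis
    by (simp add: sum.Sigma fin)
qed

text \<open>
  The net inflow is the adjoint of the discrete gradient \<open>h (snd e) - h (fst e)\<close>. This is how the heights, which
  live on vertices, turn into the potential differences, which live on arcs.
\<close>

lemma (in pair_fin_digraph) sum_net_inflow:
  "(\<Sum>i\<in>pverts G. h i * net_inflow G x i) = - (\<Sum>e\<in>parcs G. (h (fst e) - h (snd e)) * x e)"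
proof -
  have "(\<Sum>i\<in>pverts G. h i * net_inflow G x i) =
      (\<Sum>i\<in>pverts G. \<Sum>j\<in>in_nbrs G i. h (snd (j, i)) * x (j, i)) -
      (\<Sum>i\<in>pverts G. \<Sum>j\<in>out_nbrs G i. h (fst (i, j)) * x (i, j))"
    by (simp add: net_inflow_def right_diff_distrib sum_distrib_left sum_subtractf)
  also have "\<dots> = (\<Sum>e\<in>parcs G. h (snd e) * x e) - (\<Sum>e\<in>parcs G. h (fst e) * x e)"
    by (simp only: sum_in_nbrs[of "\<lambda>e. h (snd e) * x e"] sum_out_nbrs[of "\<lambda>e. h (fst e) * x e"])
  finally show ?thesis
    by (simp add: left_diff_distrib sum_subtractf)
qed

section \<open>The energy of a pseudo-flow\<close>

locale multicommodity_network = pair_fin_digraph G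
  for G :: "'v pair_pre_digraph" +
  fixes K :: nat
    and u :: "'v \<times> 'v \<Rightarrow> real"
    and s t :: "nat \<Rightarrow> 'v"
    and d :: "nat \<Rightarrow> real"
  assumes degree: "\<And>i. i \<in> pverts G \<Longrightarrow> vdegree G i \<ge> 1"
begin

abbreviation ht :: "'v flow \<Rightarrow> 'v \<Rightarrow> nat \<Rightarrow> real" where
  "ht \<equiv> height G s t d"

abbreviation cong :: "'v flow \<Rightarrow> 'v \<times> 'v \<Rightarrow> real" where
  "cong \<equiv> congestion K u"

abbreviation pot :: "'v flow \<Rightarrow> 'v \<times> 'v \<Rightarrow> nat \<Rightarrow> real" where
  "pot \<equiv> potential_diff G K u s t d"

definition energy :: "'v flow \<Rightarrow> real" where
  "energy f = (\<Sum>k\<in>{1..K}. \<Sum>i\<in>pverts G. real (vdegree G i) * (ht f i k)\<^sup>2)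
            + (\<Sum>e\<in>parcs G. (cong f e)\<^sup>2)"

text \<open>Minus one half of the derivative of the energy at \<open>f\<close> in direction \<open>g\<close>.\<close>

definition slope :: "'v flow \<Rightarrow> 'v flow \<Rightarrow> real" where
  "slope f g = (\<Sum>k\<in>{1..K}. \<Sum>e\<in>parcs G. pot f e k * g e k)"

text \<open>The quadratic form that bounds the second-order part of the energy in direction \<open>g\<close>.\<close>

definition curvature :: "'v flow \<Rightarrow> real" where
  "curvature g =
    (\<Sum>k\<in>{1..K}. \<Sum>i\<in>pverts G. real (vdegree G i) * (net_inflow G (\<lambda>e. g e k) i / vdegree G i)\<^sup>2)
    + (\<Sum>e\<in>parcs G. (total_flow K g e)\<^sup>2)"

lemma energy_nonneg: "energy f \<ge> 0"
  by (simp add: energy_def sum_nonneg)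

lemma energy_zero_iff:
  "energy f = 0 \<longleftrightarrow> (\<forall>e\<in>parcs G. cong f e = 0) \<and> (\<forall>i\<in>pverts G. \<forall>k\<in>{1..K}. ht f i k = 0)"
proof -
  have "energy f = 0 \<longleftrightarrow>
      (\<Sum>k\<in>{1..K}. \<Sum>i\<in>pverts G. real (vdegree G i) * (ht f i k)\<^sup>2) = 0 \<and>
      (\<Sum>e\<in>parcs G. (cong f e)\<^sup>2) = 0"
    unfolding energy_def by (intro add_nonneg_eq_0_iff sum_nonneg) auto
  also have "\<dots> \<longleftrightarrow> (\<forall>k\<in>{1..K}. \<forall>i\<in>pverts G. ht f i k = 0) \<and> (\<forall>e\<in>parcs G. cong f e = 0)"
    using degree by (fastforce simp: sum_nonneg_eq_0_iff sum_nonneg)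
  finally show ?thesis
    by blast
qed

lemma height_zero_iff: "i \<in> pverts G \<Longrightarrow> ht f i k = 0 \<longleftrightarrow> excess G s t d f i k = 0"
  using degree[of i] by (simp add: height_def)

lemma feasible_iff_energy_zero:
  "f \<in> mcf_feasible_region G K u s t d \<longleftrightarrow> pseudo_flow G K f \<and> energy f = 0"
proof -
  have "cong f e = 0 \<longleftrightarrow> total_flow K f e \<le> u e" for e
    by (simp add: congestion_def)
  moreover have "excess G s t d f i k = 0 \<longleftrightarrow>
      (\<Sum>j\<in>out_nbrs G i. f (i, j) k) - (\<Sum>j\<in>in_nbrs G i. f (j, i) k) = net_supply s t d i k" for i k
    by (auto simp: excess_def)
  ultimately show ?thesis
    unfolding mcf_feasible_region_def pseudo_flow_def energy_zero_iff
    by (simp add: height_zero_iff) blast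
qed

lemma zero_stable_iff_energy_zero:
  "zero_stable G K u s t d f \<longleftrightarrow> stable G K u s t d f \<and> energy f = 0"
  by (simp add: zero_stable_def energy_zero_iff)

section \<open>First- and second-order bounds on the energy\<close>

lemma height_add:
  "ht (\<lambda>e k. f e k + g e k) i k = ht f i k + net_inflow G (\<lambda>e. g e k) i / vdegree G i"
  by (simp add: height_def excess_eq_net_inflow net_inflow_add add_divide_distrib)

lemma total_flow_add: "total_flow K (\<lambda>e k. f e k + g e k) e = total_flow K f e + total_flow K g e"
  by (simp add: total_flow_def sum.distrib)

lemma total_flow_scale: "total_flow K (\<lambda>e k. c * g e k) e = c * total_flow K g e"
  by (simp add: total_flow_def sum_distrib_left)

lemma slope_eq:
  "slope f g = - (\<Sum>k\<in>{1..K}. \<Sum>i\<in>pverts G. ht f i k * net_inflow G (\<lambda>e. g e k) i)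
             - (\<Sum>e\<in>parcs G. cong f e * total_flow K g e)"
proof -
  have "slope f g = (\<Sum>k\<in>{1..K}. \<Sum>e\<in>parcs G. (ht f (fst e) k - ht f (snd e) k) * g e k)
      - (\<Sum>k\<in>{1..K}. \<Sum>e\<in>parcs G. cong f e * g e k)"
    by (simp add: slope_def potential_diff_def left_diff_distrib sum_subtractf)
  also have "(\<Sum>k\<in>{1..K}. \<Sum>e\<in>parcs G. cong f e * g e k) =
      (\<Sum>e\<in>parcs G. cong f e * total_flow K g e)"
    by (subst sum.swap) (simp add: total_flow_def sum_distrib_left)
  finally show ?thesis
    by (simp add: sum_net_inflow sum_negf)
qed

text \<open>
  The height part of the energy is a quadratic polynomial along every line, so only the congestion
  part calls for estimates.
\<close>

lemma height_energy_expansion: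
  "(\<Sum>k\<in>{1..K}. \<Sum>i\<in>pverts G. real (vdegree G i) * (ht (\<lambda>e k. f e k + g e k) i k)\<^sup>2) =
    (\<Sum>k\<in>{1..K}. \<Sum>i\<in>pverts G. real (vdegree G i) * (ht f i k)\<^sup>2)
    + 2 * (\<Sum>k\<in>{1..K}. \<Sum>i\<in>pverts G. ht f i k * net_inflow G (\<lambda>e. g e k) i)
    + (\<Sum>k\<in>{1..K}. \<Sum>i\<in>pverts G.
        real (vdegree G i) * (net_inflow G (\<lambda>e. g e k) i / vdegree G i)\<^sup>2)"
proof -
  have expand: "real (vdegree G i) * (ht (\<lambda>e k. f e k + g e k) i k)\<^sup>2 =
      real (vdegree G i) * (ht f i k)\<^sup>2 + 2 * (ht f i k * net_inflow G (\<lambda>e. g e k) i)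
      + real (vdegree G i) * (net_inflow G (\<lambda>e. g e k) i / vdegree G i)\<^sup>2"
    if "i \<in> pverts G" for i k
    using degree[OF that] unfolding height_add
    by (simp add: power2_eq_square field_simps)
  show ?thesis
    by (simp add: expand sum.distrib sum_distrib_left cong: sum.cong)
qed

text \<open>
  The squared congestion is $(\max\,0\,(x - u_e))^2$ as a function of the total flow $x$. It is convex,
  which gives the lower bound, and its derivative is $2$-Lipschitz, which gives the upper bound.
\<close>

lemma congestion_add_ge:
  "(cong f e)\<^sup>2 + 2 * (cong f e * total_flow K g e) \<le> (cong (\<lambda>e k. f e k + g e k) e)\<^sup>2"
proof -
  define a where "a = total_flow K f e - u e"
  define b where "b = total_flow K g e"
  have "a\<^sup>2 + 2 * (a * b) = (a + b)\<^sup>2 - b\<^sup>2"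
    by (simp add: power2_sum)
  \<comment> \<open>The step relieves the congestion with room to spare, and the tangent is below zero.\<close>
  moreover have "a\<^sup>2 + 2 * (a * b) \<le> 0" if "a > 0" "a + b \<le> 0"
  proof -
    have "a * (a + 2 * b) \<le> 0"
      using that by (intro mult_nonneg_nonpos) auto
    then show ?thesis
      by (simp add: power2_eq_square algebra_simps)
  qed
  ultimately show ?thesis
    by (auto simp: congestion_def total_flow_add simp flip: a_def b_def)
       (auto simp: a_def b_def algebra_simps)
qed

lemma congestion_add_le:
  "(cong (\<lambda>e k. f e k + g e k) e)\<^sup>2 \<le> (cong f e + total_flow K g e)\<^sup>2"
proof (cases "total_flow K f e + total_flow K g e \<le> u e")
  case False
  then have "0 \<le> cong (\<lambda>e k. f e k + g e k) e"
    "cong (\<lambda>e k. f e k + g e k) e \<le> cong f e + total_flow K g e"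
    by (auto simp: congestion_def total_flow_add)
  then show ?thesis
    by (intro power_mono)
qed (simp add: congestion_def total_flow_add)

lemma energy_ge_tangent: "energy f - 2 * slope f g \<le> energy (\<lambda>e k. f e k + g e k)"
proof -
  have "(\<Sum>e\<in>parcs G. (cong f e)\<^sup>2 + 2 * (cong f e * total_flow K g e))
      \<le> (\<Sum>e\<in>parcs G. (cong (\<lambda>e k. f e k + g e k) e)\<^sup>2)"
    by (intro sum_mono congestion_add_ge)
  then have "(\<Sum>e\<in>parcs G. (cong f e)\<^sup>2) + 2 * (\<Sum>e\<in>parcs G. cong f e * total_flow K g e)
      \<le> (\<Sum>e\<in>parcs G. (cong (\<lambda>e k. f e k + g e k) e)\<^sup>2)"
    by (simp add: sum.distrib sum_distrib_left)
  moreover have "0 \<le> (\<Sum>k\<in>{1..K}. \<Sum>i\<in>pverts G.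
      real (vdegree G i) * (net_inflow G (\<lambda>e. g e k) i / vdegree G i)\<^sup>2)"
    by (intro sum_nonneg) auto
  ultimately show ?thesis
    unfolding energy_def slope_eq height_energy_expansion by argo
qed

lemma energy_le_quadratic:
  "energy (\<lambda>e k. f e k + g e k) \<le> energy f - 2 * slope f g + curvature g"
proof -
  have "(\<Sum>e\<in>parcs G. (cong (\<lambda>e k. f e k + g e k) e)\<^sup>2)
      \<le> (\<Sum>e\<in>parcs G. (cong f e + total_flow K g e)\<^sup>2)"
    by (intro sum_mono congestion_add_le)
  also have "\<dots> = (\<Sum>e\<in>parcs G. (cong f e)\<^sup>2) + 2 * (\<Sum>e\<in>parcs G. cong f e * total_flow K g e)
      + (\<Sum>e\<in>parcs G. (total_flow K g e)\<^sup>2)"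
    by (simp add: power2_sum sum.distrib sum_distrib_left mult.assoc)
  finally show ?thesis
    unfolding energy_def slope_eq curvature_def height_energy_expansion by argo
qed

lemma slope_scale: "slope f (\<lambda>e k. c * g e k) = c * slope f g"
  by (simp add: slope_def sum_distrib_left mult.left_commute)

lemma curvature_scale: "curvature (\<lambda>e k. c * g e k) = c\<^sup>2 * curvature g"
  by (simp add: curvature_def net_inflow_scale total_flow_scale power_mult_distrib power_divide
      sum_distrib_left distrib_left mult.left_commute)

lemma curvature_nonneg: "curvature g \<ge> 0"
  by (simp add: curvature_def sum_nonneg)

section \<open>Stable pseudo-flows minimise the energy\<close>

text \<open>
  By complementary slackness, the potential differences of \<open>f\<close> pair to zero with \<open>f\<close> and to a
  nonpositive number with \<open>g\<close>. So the energy does not decrease to first order from \<open>f\<close> towards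
  \<open>g\<close>, and convexity does the rest.
\<close>

lemma stable_energy_minimal:
  assumes "stable G K u s t d f" and "pseudo_flow G K g"
  shows "energy f \<le> energy g"
proof -
  have "pot f e k * (g e k - f e k) \<le> 0" if "k \<in> {1..K}" "e \<in> parcs G" for e k
  proof -
    from that assms(1) have "f e k > 0 \<Longrightarrow> pot f e k = 0" "f e k = 0 \<Longrightarrow> pot f e k \<le> 0" "0 \<le> f e k"
      by (auto simp: stable_def pseudo_flow_def)
    moreover have "0 \<le> g e k"
      using that assms(2) by (auto simp: pseudo_flow_def)
    ultimately show ?thesis
      by (cases "f e k = 0") (auto simp: mult_nonpos_nonneg)
  qed
  then have "slope f (\<lambda>e k. g e k - f e k) \<le> 0"
    unfolding slope_def by (intro sum_nonpos) auto
  then show ?thesis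
    using energy_ge_tangent[of f "\<lambda>e k. g e k - f e k"] by simp
qed

section \<open>Existence of a stable pseudo-flow\<close>

definition unit_flow :: "'v \<times> 'v \<Rightarrow> nat \<Rightarrow> 'v flow" where
  "unit_flow e k = (\<lambda>e' k'. of_bool (e' = e \<and> k' = k))"

lemma slope_unit_flow:
  assumes "e \<in> parcs G" "k \<in> {1..K}"
  shows "slope f (unit_flow e k) = pot f e k"
proof -
  have "slope f (unit_flow e k) =
      (\<Sum>k'\<in>{1..K}. \<Sum>e'\<in>parcs G. if e' = e then if k' = k then pot f e k else 0 else 0)"
    unfolding slope_def unit_flow_def by (intro sum.cong refl) auto
  then show ?thesis
    using assms by simp
qed

lemma continuous_on_entry: "continuous_on A (\<lambda>f :: 'v flow. f e k)"
  by (rule continuous_on_product_then_coordinatewise[OF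
        continuous_on_product_then_coordinatewise[OF continuous_on_id]])

lemma continuous_on_energy: "continuous_on A energy"
proof -
  have cong_max: "congestion K u = (\<lambda>f e. max 0 (total_flow K f e - u e))"
    by (auto simp: congestion_def fun_eq_iff)
  show ?thesis
    unfolding energy_def height_def excess_def cong_max total_flow_def divide_inverse
    by (intro continuous_intros continuous_on_entry)
qed

lemma compact_Pi_UNIV:
  fixes A :: "'a \<Rightarrow> 'b :: topological_space set"
  assumes "\<And>i. compact (A i)"
  shows "compact (Pi UNIV A)"
proof -
  have "compactin (product_topology (\<lambda>i. euclidean) UNIV) (Pi\<^sub>E UNIV A)"
    unfolding compactin_PiE using assms by (simp add: compactin_euclidean_iff)
  then show ?thesis
    by (simp add: PiE_UNIV_domain compactin_euclidean_iff euclidean_product_topology)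
qed

text \<open>
  Entries are nonnegative, so no other commodity can offset a large one: it congests its arc by at
  least $c + 1$, and $(c + 1)^2 > c$.
\<close>

lemma energy_large:
  assumes "pseudo_flow G K f" "e \<in> parcs G" "k \<in> {1..K}" "c \<ge> 0" "f e k \<ge> \<bar>u e\<bar> + c + 1"
  shows "energy f > c"
proof -
  have "f e k \<le> total_flow K f e"
    unfolding total_flow_def using assms by (intro member_le_sum) (auto simp: pseudo_flow_def)
  then have "c + 1 \<le> cong f e"
    using assms by (auto simp: congestion_def)
  then have "(c + 1)\<^sup>2 \<le> (cong f e)\<^sup>2"
    using assms by (intro power_mono) auto
  also have "\<dots> \<le> (\<Sum>e\<in>parcs G. (cong f e)\<^sup>2)"
    using assms by (intro member_le_sum) auto
  also have "\<dots> \<le> energy f"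
    by (simp add: energy_def sum_nonneg)
  finally have "(c + 1)\<^sup>2 \<le> energy f" .
  moreover have "c < (c + 1)\<^sup>2"
    using assms by (simp add: power2_sum add_nonneg_pos)
  ultimately show ?thesis
    by linarith
qed

lemma nonpos_if_le_quadratic:
  fixes p :: real
  assumes "m > 0" "C \<ge> 0" and le: "\<And>b. 0 < b \<Longrightarrow> b \<le> m \<Longrightarrow> 2 * (b * p) \<le> b\<^sup>2 * C"
  shows "p \<le> 0"
proof (rule ccontr)
  assume "\<not> p \<le> 0"
  define b where "b = min m (p / (C + 1))"
  have b: "0 < b" "b \<le> m"
    using assms \<open>\<not> p \<le> 0\<close> by (auto simp: b_def)
  then have "b * (2 * p) \<le> b * (b * C)"
    using le[OF b] by (simp add: power2_eq_square algebra_simps)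
  then have "2 * p \<le> b * C"
    using b by simp
  also have "\<dots> \<le> p / (C + 1) * C"
    using assms by (intro mult_right_mono) (auto simp: b_def)
  also have "\<dots> \<le> p"
    using assms \<open>\<not> p \<le> 0\<close> by (simp add: field_simps)
  finally show False
    using \<open>\<not> p \<le> 0\<close> by simp
qed

text \<open>
  Along a coordinate axis, a step $c$ changes the energy by at most $-2 c\,\phi_{e,k} + O(c^2)$, so
  a potential difference of the wrong sign would allow a decrease. Steps with $c < 0$ are available
  only if the coordinate is positive, whence the asymmetry between the two clauses of stability.
\<close>

lemma potential_diff_at_coordinate_min:
  assumes "e \<in> parcs G" "k \<in> {1..K}" "f e k \<ge> 0" "\<epsilon> > 0"
    and min: "\<And>c. \<bar>c\<bar> \<le> \<epsilon> \<Longrightarrow> 0 \<le> f e k + c \<Longrightarrow>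
      energy f \<le> energy (\<lambda>e' k'. f e' k' + c * unit_flow e k e' k')"
  shows "pot f e k \<le> 0" and "f e k > 0 \<Longrightarrow> pot f e k = 0"
proof -
  let ?C = "curvature (unit_flow e k)"
  have step: "2 * (c * pot f e k) \<le> c\<^sup>2 * ?C" if "\<bar>c\<bar> \<le> \<epsilon>" "0 \<le> f e k + c" for c
  proof -
    have "energy f \<le> energy (\<lambda>e' k'. f e' k' + c * unit_flow e k e' k')"
      by (rule min[OF that])
    also have "\<dots> \<le> energy f - 2 * (c * pot f e k) + c\<^sup>2 * ?C"
      using energy_le_quadratic[of f "\<lambda>e' k'. c * unit_flow e k e' k'"] assms(1,2)
      by (simp only: slope_scale curvature_scale slope_unit_flow)
    finally show ?thesis
      by simp
  qed
  show nonpos: "pot f e k \<le> 0"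
    using assms(3) step
    by (intro nonpos_if_le_quadratic[OF \<open>\<epsilon> > 0\<close> curvature_nonneg[of "unit_flow e k"]]) auto
  show "pot f e k = 0" if "f e k > 0"
  proof -
    have "- pot f e k \<le> 0"
    proof (rule nonpos_if_le_quadratic[OF _ curvature_nonneg[of "unit_flow e k"]])
      show "0 < min \<epsilon> (f e k)"
        using that \<open>\<epsilon> > 0\<close> by simp
      show "2 * (b * - pot f e k) \<le> b\<^sup>2 * ?C" if "0 < b" "b \<le> min \<epsilon> (f e k)" for b
        using step[of "- b"] that by simp
    qed
    then show ?thesis
      using nonpos by simp
  qed
qed

lemma stable_exists: "\<exists>f. stable G K u s t d f"
proof -
  define M where "M e = \<bar>u e\<bar> + energy (\<lambda>e k. 0) + 1" for e
  have M_pos: "M e > 0" for e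
    using energy_nonneg[of "\<lambda>e k. 0"] by (simp add: M_def add_nonneg_pos)
  \<comment> \<open>Entries at pairs that are not arcs, or at indices that are not commodities, leave the energy
    unchanged. They are bounded as well, so that the box is a product of intervals and compact by
    Tychonoff's theorem.\<close>
  define B :: "'v flow set" where "B = {f. \<forall>e k. f e k \<in> {0..M e}}"
  have "B = Pi UNIV (\<lambda>e. Pi UNIV (\<lambda>k. {0..M e}))"
    by (simp add: B_def Pi_def del: split_paired_All)
  then have "compact B"
    by (simp add: compact_Pi_UNIV)
  moreover have zero_mem: "(\<lambda>e k. 0) \<in> B"
    using M_pos by (simp add: B_def less_imp_le)
  ultimately obtain f where "f \<in> B" and min: "\<And>g. g \<in> B \<Longrightarrow> energy f \<le> energy g"
    using continuous_attains_inf[of B energy] continuous_on_energy by blast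
  then have box: "0 \<le> f e k" "f e k \<le> M e" for e k
    by (simp_all add: B_def del: split_paired_All)
  then have pf: "pseudo_flow G K f"
    by (simp add: pseudo_flow_def)
  have potential: "pot f e k \<le> 0 \<and> (f e k > 0 \<longrightarrow> pot f e k = 0)"
    if e: "e \<in> parcs G" and k: "k \<in> {1..K}" for e k
  proof -
    have "f e k < M e"
    proof (rule ccontr)
      assume "\<not> f e k < M e"
      then have "energy f > energy (\<lambda>e k. 0)"
        by (intro energy_large[OF pf e k energy_nonneg]) (simp add: M_def)
      then show False
        using min[OF zero_mem] by simp
    qed
    then have slack: "M e - f e k > 0"
      by simp
    have "energy f \<le> energy (\<lambda>e' k'. f e' k' + c * unit_flow e k e' k')"
      if "\<bar>c\<bar> \<le> M e - f e k" "0 \<le> f e k + c" for c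
      using that box by (intro min) (auto simp: B_def unit_flow_def)
    from potential_diff_at_coordinate_min[OF e k box(1) slack this] show ?thesis
      by blast
  qed
  then have "stable G K u s t d f"
    using pf by (auto simp: stable_def)
  then show ?thesis
    by blast
qed

section \<open>Infeasibility and nonzero-stable pseudo-flows\<close>

theorem infeasible_iff_nonzero_stable:
  "mcf_feasible_region G K u s t d = {} \<longleftrightarrow> (\<exists>f. nonzero_stable G K u s t d f)"
proof
  assume infeasible: "mcf_feasible_region G K u s t d = {}"
  obtain f where f: "stable G K u s t d f"
    using stable_exists by blast
  then have "energy f \<noteq> 0"
    using infeasible feasible_iff_energy_zero[of f] by (auto simp: stable_def)
  with f show "\<exists>f. nonzero_stable G K u s t d f"
    by (auto simp: nonzero_stable_def zero_stable_iff_energy_zero)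
next
  assume "\<exists>f. nonzero_stable G K u s t d f"
  then obtain f where f: "stable G K u s t d f" "energy f \<noteq> 0"
    by (auto simp: nonzero_stable_def zero_stable_iff_energy_zero)
  have "g \<notin> mcf_feasible_region G K u s t d" for g
    using stable_energy_minimal[OF f(1), of g] f(2) energy_nonneg[of f]
    by (auto simp: feasible_iff_energy_zero)
  then show "mcf_feasible_region G K u s t d = {}"
    by blast
qed

end

theorem theorem2:
  fixes G :: "'v pair_pre_digraph"
    and K :: nat
    and u :: "'v \<times> 'v \<Rightarrow> real"
    and s t :: "nat \<Rightarrow> 'v"
    and d :: "nat \<Rightarrow> real"
  assumes graph: "pair_fin_digraph G"
    and degree: "\<And>i. i \<in> pverts G \<Longrightarrow> vdegree G i \<ge> 1"
    and capacity: "\<And>e. e \<in> parcs G \<Longrightarrow> u e \<in> \<rat> \<and> u e > 0"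
    and origin: "\<And>k. k \<in> {1..K} \<Longrightarrow> s k \<in> pverts G"
    and destination: "\<And>k. k \<in> {1..K} \<Longrightarrow> t k \<in> pverts G"
    and distinct_ends: "\<And>k. k \<in> {1..K} \<Longrightarrow> s k \<noteq> t k"
  shows "mcf_feasible_region G K u s t d = {} \<longleftrightarrow> (\<exists>f. nonzero_stable G K u s t d f)"
proof -
  interpret pair_fin_digraph G
    by (rule graph)
  interpret multicommodity_network G K u s t d
    by unfold_locales (rule degree)
  show ?thesis
    by (rule infeasible_iff_nonzero_stable)
qed

end
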